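(* Let $(G,M)$ be a square graph with squares $C_1,\dots,C_t$ and let $c\in\mathbb{R}^{E(G)}$. For each square $C$ let $w_C$ be the absolute value of the difference of the costs of the two perfect matchings of $C$, and order the squares so that $w_{C_1}\ge w_{C_2}\ge\dots\ge w_{C_t}$. Run the following procedure (HAM): starting from the graph $G$, for $i=1,\dots,t$ in turn, keep exactly one of the two perfect matchings of $C_i$ and delete both edges of the other from the current graph, where: if the current graph remains connected under both choices, keep the perfect matching of $C_i$ of smaller cost (ties broken arbitrarily); if it remains connected under exactly one of the two choices, make that choice. Then at each step at least one of the two choices keeps the graph connected, and the final graph is a Hamiltonian cycle of $G$ containing $M$ of minimum cost among all Hamiltonian cycles of $G$ containing $M$.
   Context: A square graph is a pair $(G,M)$ where $G=(V,E)$ is a cubic $2$-edge-connected graph and $M$ is a perfect matching of $G$ such that the edges of $E\setminus M$ form a node-disjoint union of $4$-cycles, called squares. Each square, being a $4$-cycle, has exactly two perfect matchings (pairs of opposite edges). The cost of an edge set is the sum of the costs of its edges. *)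

theory Defs
  imports Complex_Main
begin

text \<open>
  A graph has a set \<open>V\<close> of vertices, a set \<open>E\<close> of edges and a map \<open>ends\<close> that gives the set
  of the two ends of an edge. Parallel edges are allowed; a simple graph is the case where \<open>ends\<close>
  is injective on \<open>E\<close>, for example \<open>ends = id\<close> on a set of two-element sets. Loops are left out:
  in a cubic graph a loop forces a bridge. A spanning subgraph is given by its set of edges.
\<close>

definition finite_graph :: "'v set \<Rightarrow> 'e set \<Rightarrow> ('e \<Rightarrow> 'v set) \<Rightarrow> bool" where
  "finite_graph V E ends \<longleftrightarrow>
     finite V \<and> finite E \<and> (\<forall>e\<in>E. ends e \<subseteq> V \<and> card (ends e) = 2)"

definition graph_connected :: "'v set \<Rightarrow> ('e \<Rightarrow> 'v set) \<Rightarrow> 'e set \<Rightarrow> bool" where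
  "graph_connected V ends F \<longleftrightarrow>
     V \<noteq> {} \<and> (\<forall>u\<in>V. \<forall>v\<in>V. (\<lambda>x y. \<exists>e\<in>F. ends e = {x, y})\<^sup>*\<^sup>* u v)"

definition two_edge_connected :: "'v set \<Rightarrow> ('e \<Rightarrow> 'v set) \<Rightarrow> 'e set \<Rightarrow> bool" where
  "two_edge_connected V ends E \<longleftrightarrow>
     graph_connected V ends E \<and> (\<forall>e\<in>E. graph_connected V ends (E - {e}))"

definition cubic :: "'v set \<Rightarrow> ('e \<Rightarrow> 'v set) \<Rightarrow> 'e set \<Rightarrow> bool" where
  "cubic V ends E \<longleftrightarrow> (\<forall>v\<in>V. card {e \<in> E. v \<in> ends e} = 3)"

definition perfect_matching :: "'v set \<Rightarrow> ('e \<Rightarrow> 'v set) \<Rightarrow> 'e set \<Rightarrow> 'e set \<Rightarrow> bool" where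
  "perfect_matching V ends E P \<longleftrightarrow> P \<subseteq> E \<and> (\<forall>v\<in>V. \<exists>!e. e \<in> P \<and> v \<in> ends e)"

text \<open>
  \<open>cycle_on W ends F\<close>: the edges of \<open>F\<close> form one cycle with vertex set \<open>W\<close>. A cycle of length
  two consists of two parallel edges.
\<close>

definition cycle_on :: "'v set \<Rightarrow> ('e \<Rightarrow> 'v set) \<Rightarrow> 'e set \<Rightarrow> bool" where
  "cycle_on W ends F \<longleftrightarrow>
     (\<exists>vs es. distinct vs \<and> set vs = W \<and> distinct es \<and> set es = F \<and>
        length es = length vs \<and> 2 \<le> length vs \<and>
        (\<forall>i < length vs. ends (es ! i) = {vs ! i, vs ! (Suc i mod length vs)}))"

definition verts_of :: "('e \<Rightarrow> 'v set) \<Rightarrow> 'e set \<Rightarrow> 'v set" where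
  "verts_of ends F = (\<Union>e\<in>F. ends e)"

definition four_cycle :: "('e \<Rightarrow> 'v set) \<Rightarrow> 'e set \<Rightarrow> bool" where
  "four_cycle ends C \<longleftrightarrow> card C = 4 \<and> cycle_on (verts_of ends C) ends C"

definition square_decomposition :: "('e \<Rightarrow> 'v set) \<Rightarrow> 'e set \<Rightarrow> 'e set set \<Rightarrow> bool" where
  "square_decomposition ends F S \<longleftrightarrow>
     \<Union>S = F \<and> (\<forall>C\<in>S. four_cycle ends C) \<and>
     (\<forall>C\<in>S. \<forall>D\<in>S. C \<noteq> D \<longrightarrow> verts_of ends C \<inter> verts_of ends D = {})"

definition square_graph :: "'v set \<Rightarrow> 'e set \<Rightarrow> ('e \<Rightarrow> 'v set) \<Rightarrow> 'e set \<Rightarrow> bool" where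
  "square_graph V E ends M \<longleftrightarrow>
     finite_graph V E ends \<and> cubic V ends E \<and> two_edge_connected V ends E \<and>
     perfect_matching V ends E M \<and> (\<exists>S. square_decomposition ends (E - M) S)"

definition hamiltonian_cycle :: "'v set \<Rightarrow> 'e set \<Rightarrow> ('e \<Rightarrow> 'v set) \<Rightarrow> 'e set \<Rightarrow> bool" where
  "hamiltonian_cycle V E ends F \<longleftrightarrow> F \<subseteq> E \<and> cycle_on V ends F"

definition cost :: "('e \<Rightarrow> real) \<Rightarrow> 'e set \<Rightarrow> real" where
  "cost c F = (\<Sum>e\<in>F. c e)"

definition square_matchings :: "('e \<Rightarrow> 'v set) \<Rightarrow> 'e set \<Rightarrow> 'e set set" where
  "square_matchings ends C = {P. perfect_matching (verts_of ends C) ends C P}"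

definition square_weight :: "('e \<Rightarrow> 'v set) \<Rightarrow> ('e \<Rightarrow> real) \<Rightarrow> 'e set \<Rightarrow> real" where
  "square_weight ends c C =
     (THE w. \<exists>P Q. P \<noteq> Q \<and> square_matchings ends C = {P, Q} \<and> w = \<bar>cost c P - cost c Q\<bar>)"

text \<open>
  One step of HAM at the square \<open>C\<close>, from the current graph \<open>H\<close> to \<open>H'\<close>: \<open>P\<close> is the matching
  kept and \<open>Q\<close> the matching deleted. Nothing is prescribed if neither choice leaves the graph
  connected, so that a step exists in every case.
\<close>

definition ham_step ::
  "'v set \<Rightarrow> ('e \<Rightarrow> 'v set) \<Rightarrow> ('e \<Rightarrow> real) \<Rightarrow> 'e set \<Rightarrow> 'e set \<Rightarrow> 'e set \<Rightarrow> bool" where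
  "ham_step V ends c C H H' \<longleftrightarrow>
     (\<exists>P Q. P \<noteq> Q \<and> square_matchings ends C = {P, Q} \<and> H' = H - Q \<and>
        (graph_connected V ends (H - P) \<and> graph_connected V ends (H - Q) \<longrightarrow>
           cost c P \<le> cost c Q) \<and>
        (graph_connected V ends (H - P) \<noteq> graph_connected V ends (H - Q) \<longrightarrow>
           graph_connected V ends (H - Q)))"

text \<open>\<open>H i\<close> is the current graph after the first \<open>i\<close> squares of the list.\<close>

definition ham_run ::
  "'v set \<Rightarrow> 'e set \<Rightarrow> ('e \<Rightarrow> 'v set) \<Rightarrow> ('e \<Rightarrow> real) \<Rightarrow> 'e set list \<Rightarrow> (nat \<Rightarrow> 'e set) \<Rightarrow> bool" where
  "ham_run V E ends c Cs H \<longleftrightarrow>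
     H 0 = E \<and> (\<forall>i < length Cs. ham_step V ends c (Cs ! i) (H i) (H (Suc i)))"

lemma four_cycle_matchings:
  assumes "four_cycle ends C"
  obtains P Q where "P \<noteq> Q" "P \<union> Q = C" "P \<inter> Q = {}" "card P = 2" "card Q = 2"
    "square_matchings ends C = {P, Q}"
proof -
  obtain vs es where vs: "distinct vs" "set vs = verts_of ends C"
    and es: "distinct es" "set es = C" and len: "length es = length vs"
    and inc: "\<forall>i < length vs. ends (es ! i) = {vs ! i, vs ! (Suc i mod length vs)}"
    using assms unfolding four_cycle_def cycle_on_def by blast
  have "length es = 4"
    using assms es unfolding four_cycle_def by (metis distinct_card)
  then obtain e0 e1 e2 e3 where e: "es = [e0, e1, e2, e3]"
    by (auto simp: numeral_eq_Suc length_Suc_conv)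
  have "length vs = 4" using len \<open>length es = 4\<close> by simp
  then obtain a b x d where v: "vs = [a, b, x, d]"
    by (auto simp: numeral_eq_Suc length_Suc_conv)
  have ends: "ends e0 = {a, b}" "ends e1 = {b, x}" "ends e2 = {x, d}" "ends e3 = {d, a}"
    using inc[rule_format, of 0] inc[rule_format, of "Suc 0"] inc[rule_format, of "Suc (Suc 0)"]
      inc[rule_format, of "Suc (Suc (Suc 0))"] by (simp_all add: e v)
  have dv: "a \<noteq> b" "a \<noteq> x" "a \<noteq> d" "b \<noteq> x" "b \<noteq> d" "x \<noteq> d"
    using vs(1) v by auto
  have de: "e0 \<noteq> e1" "e0 \<noteq> e2" "e0 \<noteq> e3" "e1 \<noteq> e2" "e1 \<noteq> e3" "e2 \<noteq> e3"
    using es(1) e by auto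
  have C: "C = {e0, e1, e2, e3}" using es(2) e by auto
  have W: "verts_of ends C = {a, b, x, d}" using vs(2) v by auto
  have pm: "perfect_matching {a, b, x, d} ends C P \<longleftrightarrow> P = {e0, e2} \<or> P = {e1, e3}" for P
  proof
    assume P: "perfect_matching {a, b, x, d} ends C P"
    then have sub: "P \<subseteq> {e0, e1, e2, e3}" by (simp add: perfect_matching_def C)
    have one: "(f \<in> P) \<noteq> (g \<in> P)"
      if y: "y \<in> {a, b, x, d}" and fg: "f \<noteq> g" "\<And>e. e \<in> C \<Longrightarrow> y \<in> ends e \<longleftrightarrow> e = f \<or> e = g"
        and in_C: "f \<in> C" "g \<in> C" for y f g
    proof -
      obtain e where "e \<in> P" "y \<in> ends e" and uniq: "\<And>e'. e' \<in> P \<Longrightarrow> y \<in> ends e' \<Longrightarrow> e' = e"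
        using P y unfolding perfect_matching_def by blast
      moreover have "e = f \<or> e = g" using calculation sub C fg(2) by blast
      moreover have "y \<in> ends f" "y \<in> ends g" using fg(2) in_C by simp_all
      ultimately show ?thesis using fg(1) by blast
    qed
    have "(e0 \<in> P) \<noteq> (e3 \<in> P)"
      by (rule one[of a]) (use ends dv de C in auto)
    moreover have "(e0 \<in> P) \<noteq> (e1 \<in> P)"
      by (rule one[of b]) (use ends dv de C in auto)
    moreover have "(e1 \<in> P) \<noteq> (e2 \<in> P)"
      by (rule one[of x]) (use ends dv de C in auto)
    ultimately show "P = {e0, e2} \<or> P = {e1, e3}" using sub by blast
  next
    assume "P = {e0, e2} \<or> P = {e1, e3}"
    then show "perfect_matching {a, b, x, d} ends C P"
      using ends dv de by (auto simp: perfect_matching_def C)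
  qed
  show thesis
  proof (rule that[of "{e0, e2}" "{e1, e3}"])
    show "square_matchings ends C = {{e0, e2}, {e1, e3}}"
      unfolding square_matchings_def W pm by blast
  qed (use de C in auto)
qed

lemma square_weight_eq:
  assumes "P \<noteq> Q" "square_matchings ends C = {P, Q}"
  shows "square_weight ends c C = \<bar>cost c P - cost c Q\<bar>"
  unfolding square_weight_def
proof (rule the_equality)
  fix w
  assume "\<exists>P Q. P \<noteq> Q \<and> square_matchings ends C = {P, Q} \<and> w = \<bar>cost c P - cost c Q\<bar>"
  then obtain P' Q' where "{P, Q} = {P', Q'}" and w: "w = \<bar>cost c P' - cost c Q'\<bar>"
    unfolding assms(2) by (elim exE conjE)
  then have "P = P' \<and> Q = Q' \<or> P = Q' \<and> Q = P'" by (simp add: doubleton_eq_iff)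
  then show "w = \<bar>cost c P - cost c Q\<bar>"
    unfolding w by (elim disjE conjE) (simp_all add: abs_minus_commute)
qed (use assms in blast)

lemma ham_step_exists:
  assumes "four_cycle ends C"
  shows "\<exists>H'. ham_step V ends c C H H'"
proof -
  obtain P Q where PQ: "P \<noteq> Q" "square_matchings ends C = {P, Q}"
    using assms by (rule four_cycle_matchings)
  have QP: "square_matchings ends C = {Q, P}" using PQ(2) by blast
  let ?p = "graph_connected V ends (H - P)" and ?q = "graph_connected V ends (H - Q)"
  show ?thesis
  proof (cases "(?p \<and> ?q \<longrightarrow> cost c P \<le> cost c Q) \<and> (?p \<noteq> ?q \<longrightarrow> ?q)")
    case True
    show ?thesis
      unfolding ham_step_def
      by (rule exI[of _ "H - Q"], rule exI[of _ P], rule exI[of _ Q])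
        (intro conjI refl PQ True[THEN conjunct1] True[THEN conjunct2])
  next
    case False
    then have *: "(?q \<and> ?p \<longrightarrow> cost c Q \<le> cost c P) \<and> (?q \<noteq> ?p \<longrightarrow> ?p)" by linarith
    show ?thesis
      unfolding ham_step_def
      by (rule exI[of _ "H - P"], rule exI[of _ Q], rule exI[of _ P])
        (intro conjI refl PQ(1)[symmetric] QP *[THEN conjunct1] *[THEN conjunct2])
  qed
qed

end

theory Submission
  imports Defs
begin

text \<open>
  The Hamiltonian cycles containing \<open>M\<close> are the connected graphs formed by \<open>M\<close> and one perfect
  matching of every square; such a graph is 2-regular, so all its cuts are even. Suppose that
  deleting either perfect matching of a square disconnects the current graph, cutting off a vertex
  set \<open>W\<close> in the one case and \<open>U\<close> in the other. Then \<open>W \<inter> U\<close> contains exactly one vertex of the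
  square, and every 2-regular graph as above in the current graph leaves \<open>W \<inter> U\<close> by exactly one
  edge, which is absurd. Hence some choice at every square preserves connectivity. For the same
  reason the Hamiltonian cycles containing \<open>M\<close>, as sets of choices, satisfy the symmetric exchange
  axiom of delta-matroids. When HAM decides at the square \<open>C\<close> against a Hamiltonian cycle contained
  in the current graph, switching that cycle at \<open>C\<close> gains \<open>w\<^sub>C\<close>. One further switch restores
  connectivity if necessary; it takes place at an undecided square, so it costs at most \<open>w\<^sub>C\<close>.
\<close>

section \<open>Degrees and cuts\<close>

definition degree :: "('e \<Rightarrow> 'v set) \<Rightarrow> 'e set \<Rightarrow> 'v \<Rightarrow> nat" where
  "degree ends F v = card {e \<in> F. v \<in> ends e}"

lemma degree_eq_0_iff:
  assumes "finite F"
  shows "degree ends F v = 0 \<longleftrightarrow> (\<forall>e\<in>F. v \<notin> ends e)"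
  using assms by (auto simp: degree_def)

lemma degree_Diff:
  assumes "finite F" "G \<subseteq> F"
  shows "degree ends F v = degree ends G v + degree ends (F - G) v"
proof -
  have "{e \<in> F. v \<in> ends e} = {e \<in> G. v \<in> ends e} \<union> {e \<in> F - G. v \<in> ends e}"
    using assms(2) by blast
  also have "card \<dots> = degree ends G v + degree ends (F - G) v"
    unfolding degree_def
    by (rule card_Un_disjoint) (use assms in \<open>auto intro: finite_subset\<close>)
  finally show ?thesis by (simp add: degree_def)
qed

lemma sum_degree:
  assumes "finite F" "finite W"
  shows "(\<Sum>v\<in>W. degree ends F v) = (\<Sum>e\<in>F. card (ends e \<inter> W))"
proof -
  have "(\<Sum>v\<in>W. degree ends F v) = (\<Sum>e\<in>F. card {v \<in> W. v \<in> ends e})"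
    unfolding degree_def using assms by (intro sum_multicount_gen) auto
  also have "\<dots> = (\<Sum>e\<in>F. card (ends e \<inter> W))"
    by (intro sum.cong refl arg_cong[of _ _ card]) blast
  finally show ?thesis .
qed

lemma perfect_matching_iff_degree:
  "perfect_matching V ends E P \<longleftrightarrow> P \<subseteq> E \<and> (\<forall>v\<in>V. degree ends P v = 1)"
proof -
  have "(\<exists>!e. e \<in> P \<and> v \<in> ends e) \<longleftrightarrow> degree ends P v = 1" for v
    unfolding degree_def One_nat_def card_1_singleton_iff by (simp add: set_eq_iff) metis
  then show ?thesis by (simp add: perfect_matching_def)
qed

lemma finite_graph_subset: "finite_graph V E ends \<Longrightarrow> F \<subseteq> E \<Longrightarrow> finite_graph V F ends"
  unfolding finite_graph_def using finite_subset by blast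

definition edge_cut :: "('e \<Rightarrow> 'v set) \<Rightarrow> 'e set \<Rightarrow> 'v set \<Rightarrow> 'e set" where
  "edge_cut ends F W = {e \<in> F. ends e \<inter> W \<noteq> {} \<and> \<not> ends e \<subseteq> W}"

lemma edge_cut_Un: "edge_cut ends (F \<union> G) W = edge_cut ends F W \<union> edge_cut ends G W"
  by (auto simp: edge_cut_def)

lemma edge_cut_empty_mono: "edge_cut ends G W = {} \<Longrightarrow> F \<subseteq> G \<Longrightarrow> edge_cut ends F W = {}"
  by (auto simp: edge_cut_def)

lemma edge_cut_subset: "F \<subseteq> G \<Longrightarrow> edge_cut ends F W = F \<inter> edge_cut ends G W"
  by (auto simp: edge_cut_def)

lemma edge_cut_Int_subset: "edge_cut ends F (W \<inter> U) \<subseteq> edge_cut ends F W \<union> edge_cut ends F U"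
  by (auto simp: edge_cut_def)

lemma edge_cut_sym_diff:
  assumes "\<And>e. e \<in> F \<Longrightarrow> card (ends e) = 2"
  shows "edge_cut ends F (sym_diff W U) = sym_diff (edge_cut ends F W) (edge_cut ends F U)"
proof -
  have "e \<in> edge_cut ends F (sym_diff W U) \<longleftrightarrow> e \<in> sym_diff (edge_cut ends F W) (edge_cut ends F U)"
    if e: "e \<in> F" for e
  proof -
    obtain p q where "ends e = {p, q}" using assms[OF e] unfolding card_2_iff by blast
    then show ?thesis using e by (auto simp: edge_cut_def)
  qed
  then show ?thesis by (auto simp: edge_cut_def)
qed

lemma even_card_edge_cut:
  assumes graph: "finite_graph V F ends" and deg: "\<And>v. v \<in> V \<Longrightarrow> even (degree ends F v)"
  shows "even (card (edge_cut ends F W))"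
proof -
  have fin: "finite F" "finite V" using graph by (auto simp: finite_graph_def)
  have "e \<in> edge_cut ends F W \<longleftrightarrow> odd (card (ends e \<inter> (V \<inter> W)))" if e: "e \<in> F" for e
  proof -
    obtain p q where "ends e = {p, q}" "p \<noteq> q" "p \<in> V" "q \<in> V"
      using graph e unfolding finite_graph_def card_2_iff by blast
    then show ?thesis using e by (cases "p \<in> W"; cases "q \<in> W") (auto simp: edge_cut_def)
  qed
  then have "edge_cut ends F W = {e \<in> F. odd (card (ends e \<inter> (V \<inter> W)))}"
    by (auto simp: edge_cut_def)
  then have "even (card (edge_cut ends F W)) \<longleftrightarrow> even (\<Sum>e\<in>F. card (ends e \<inter> (V \<inter> W)))"
    using fin(1) by (simp add: even_sum_iff)
  also have "\<dots> \<longleftrightarrow> even (\<Sum>v\<in>V \<inter> W. degree ends F v)"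
    using fin by (simp add: sum_degree)
  also have "\<dots>" using deg by (intro dvd_sum) simp
  finally show ?thesis .
qed

lemma graph_connected_mono:
  assumes "graph_connected V ends F" "F \<subseteq> G"
  shows "graph_connected V ends G"
proof -
  have "(\<lambda>x y. \<exists>e\<in>F. ends e = {x, y})\<^sup>*\<^sup>* \<le> (\<lambda>x y. \<exists>e\<in>G. ends e = {x, y})\<^sup>*\<^sup>*"
    by (rule rtranclp_mono) (use assms(2) in blast)
  then show ?thesis using assms(1) unfolding graph_connected_def by blast
qed

lemma graph_connected_iff_edge_cut:
  assumes "\<And>e. e \<in> F \<Longrightarrow> ends e \<subseteq> V \<and> card (ends e) = 2"
  shows "graph_connected V ends F \<longleftrightarrow>
    V \<noteq> {} \<and> (\<forall>W\<subseteq>V. edge_cut ends F W = {} \<longrightarrow> W = {} \<or> W = V)"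
proof -
  let ?adj = "\<lambda>x y. \<exists>e\<in>F. ends e = {x, y}"
  have reachable_in: "v \<in> W" if "?adj\<^sup>*\<^sup>* u v" "u \<in> W" "edge_cut ends F W = {}" for u v W
    using that
  proof (induction rule: rtranclp_induct)
    case (step y z)
    then show ?case by (auto simp: edge_cut_def)
  qed
  have "?adj\<^sup>*\<^sup>* u v"
    if trivial: "\<forall>W\<subseteq>V. edge_cut ends F W = {} \<longrightarrow> W = {} \<or> W = V" and uv: "u \<in> V" "v \<in> V" for u v
  proof -
    let ?W = "{y \<in> V. ?adj\<^sup>*\<^sup>* u y}"
    have "e \<notin> edge_cut ends F ?W" for e
    proof (cases "e \<in> F")
      case True
      then obtain p q where pq: "ends e = {p, q}" using assms by (meson card_2_iff)
      then have "?adj p q" "?adj q p" using True by (auto simp: insert_commute)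
      then have "?adj\<^sup>*\<^sup>* u p \<longleftrightarrow> ?adj\<^sup>*\<^sup>* u q"
        by (intro iffI) (erule rtranclp.rtrancl_into_rtrancl, assumption)+
      moreover have "p \<in> V" "q \<in> V" using assms True pq by auto
      ultimately show ?thesis by (simp add: edge_cut_def pq)
    qed (simp add: edge_cut_def)
    then have "?W = {} \<or> ?W = V" by (intro trivial[rule_format]) auto
    then show ?thesis using uv by blast
  qed
  then show ?thesis unfolding graph_connected_def using reachable_in by blast
qed

section \<open>Cycles as connected 2-regular graphs\<close>

lemma cycle_onE:
  assumes "cycle_on V ends F"
  obtains vs es where "distinct vs" "set vs = V" "distinct es" "set es = F"
    "length es = length vs" "2 \<le> length vs"
    "\<And>i. i < length vs \<Longrightarrow> ends (es ! i) = {vs ! i, vs ! (Suc i mod length vs)}"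
proof -
  obtain vs es where "distinct vs \<and> set vs = V \<and> distinct es \<and> set es = F \<and>
      length es = length vs \<and> 2 \<le> length vs \<and>
      (\<forall>i < length vs. ends (es ! i) = {vs ! i, vs ! (Suc i mod length vs)})"
    using assms unfolding cycle_on_def by blast
  then show thesis using that[of vs es] by simp
qed

lemma cycle_on_finite_graph:
  assumes "cycle_on V ends F"
  shows "finite_graph V F ends"
proof -
  obtain vs es where vs: "distinct vs" "set vs = V" and es: "distinct es" "set es = F"
    and len: "length es = length vs" "2 \<le> length vs"
    and ends: "\<And>i. i < length vs \<Longrightarrow> ends (es ! i) = {vs ! i, vs ! (Suc i mod length vs)}"
    by (rule cycle_onE[OF assms]) (rule that)
  have "ends e \<subseteq> V \<and> card (ends e) = 2" if "e \<in> F" for e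
  proof -
    obtain i where i: "i < length vs" "e = es ! i"
      using \<open>e \<in> F\<close> es(2) len by (metis in_set_conv_nth)
    have "Suc i mod length vs < length vs" "Suc i mod length vs \<noteq> i"
      using i(1) len(2) by (auto simp: mod_Suc)
    then show ?thesis
      using i ends vs by (auto simp: nth_eq_iff_index_eq)
  qed
  then show ?thesis using vs(2) es(2) by (auto simp: finite_graph_def)
qed

lemma cycle_on_degree:
  assumes "cycle_on V ends F" "v \<in> V"
  shows "degree ends F v = 2"
proof -
  obtain vs es where vs: "distinct vs" "set vs = V" and es: "distinct es" "set es = F"
    and len: "length es = length vs" "2 \<le> length vs"
    and ends: "\<And>i. i < length vs \<Longrightarrow> ends (es ! i) = {vs ! i, vs ! (Suc i mod length vs)}"
    by (rule cycle_onE[OF assms(1)]) (rule that)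
  obtain i where i: "i < length vs" "v = vs ! i" using assms(2) vs(2) by (metis in_set_conv_nth)
  define k where "k = (if i = 0 then length vs - 1 else i - 1)"
  have k: "k < length vs" "k \<noteq> i" using i len by (auto simp: k_def)
  have "v \<in> ends (es ! j) \<longleftrightarrow> j = i \<or> j = k" if j: "j < length vs" for j
  proof -
    have "Suc j mod length vs < length vs" using j by (intro mod_less_divisor) linarith
    then have "v \<in> ends (es ! j) \<longleftrightarrow> i = j \<or> i = Suc j mod length vs"
      using vs(1) i j by (simp add: ends nth_eq_iff_index_eq)
    moreover have "i = Suc j mod length vs \<longleftrightarrow> j = k"
      using i j len by (auto simp: mod_Suc k_def)
    ultimately show ?thesis by blast
  qed
  then have "{e \<in> F. v \<in> ends e} = {es ! i, es ! k}"
    using es(2) i(1) k(1) len(1) by (auto simp: in_set_conv_nth)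
  moreover have "es ! i \<noteq> es ! k" using es(1) i(1) k len by (simp add: nth_eq_iff_index_eq)
  ultimately show ?thesis by (simp add: degree_def)
qed

lemma cycle_on_graph_connected:
  assumes "cycle_on V ends F"
  shows "graph_connected V ends F"
proof -
  obtain vs es where vs: "set vs = V" and es: "set es = F"
    and len: "length es = length vs" "2 \<le> length vs"
    and ends: "\<And>i. i < length vs \<Longrightarrow> ends (es ! i) = {vs ! i, vs ! (Suc i mod length vs)}"
    by (rule cycle_onE[OF assms]) (rule that)
  have "W = {} \<or> W = V" if W: "W \<subseteq> V" "edge_cut ends F W = {}" for W
  proof -
    have "vs ! i \<in> W \<longleftrightarrow> vs ! 0 \<in> W" if "i < length vs" for i
      using that
    proof (induction i)
      case (Suc i)
      then have "es ! i \<in> F" "ends (es ! i) = {vs ! i, vs ! Suc i}"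
        using es len ends[of i] by auto
      then have "vs ! i \<in> W \<longleftrightarrow> vs ! Suc i \<in> W" using W(2) by (auto simp: edge_cut_def)
      then show ?case using Suc by simp
    qed simp
    then have "v \<in> W \<longleftrightarrow> vs ! 0 \<in> W" if "v \<in> V" for v
      using that vs by (metis in_set_conv_nth)
    then show ?thesis using W(1) by blast
  qed
  moreover have "V \<noteq> {}" using vs len by auto
  moreover have "ends e \<subseteq> V \<and> card (ends e) = 2" if "e \<in> F" for e
    using cycle_on_finite_graph[OF assms] that by (simp add: finite_graph_def)
  ultimately show ?thesis by (simp add: graph_connected_iff_edge_cut)
qed

definition edge_path ::
  "'v set \<Rightarrow> ('e \<Rightarrow> 'v set) \<Rightarrow> 'e set \<Rightarrow> 'v list \<Rightarrow> 'e list \<Rightarrow> bool" where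
  "edge_path V ends F vs es \<longleftrightarrow>
     distinct vs \<and> set vs \<subseteq> V \<and> length vs = Suc (length es) \<and> set es \<subseteq> F \<and>
     (\<forall>i < length es. ends (es ! i) = {vs ! i, vs ! Suc i})"

lemma edge_path_Cons:
  assumes "edge_path V ends F vs es" "f \<in> F" "ends f = {u, vs ! 0}" "u \<in> V" "u \<notin> set vs"
  shows "edge_path V ends F (u # vs) (f # es)"
  using assms by (auto simp: edge_path_def nth_Cons split: nat.split)

lemma edge_path_snoc:
  assumes "edge_path V ends F vs es" "f \<in> F" "ends f = {u, vs ! length es}" "u \<in> V" "u \<notin> set vs"
  shows "edge_path V ends F (vs @ [u]) (es @ [f])"
  using assms by (auto simp: edge_path_def nth_append less_Suc_eq insert_commute)

lemma edge_path_incident: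
  assumes "edge_path V ends F vs es" "i < length es" "j \<le> length es"
  shows "vs ! j \<in> ends (es ! i) \<longleftrightarrow> j = i \<or> j = Suc i"
  using assms by (simp add: edge_path_def nth_eq_iff_index_eq)

lemma edge_path_ends_subset:
  assumes "edge_path V ends F vs es" "e \<in> set es"
  shows "ends e \<subseteq> set vs"
proof -
  obtain i where "i < length es" "e = es ! i" using assms(2) by (metis in_set_conv_nth)
  then show ?thesis using assms(1) by (simp add: edge_path_def)
qed

lemma edge_path_distinct:
  assumes "edge_path V ends F vs es"
  shows "distinct es"
  unfolding distinct_conv_nth
proof (intro allI impI notI)
  fix i j assume ij: "i < length es" "j < length es" "i \<noteq> j" "es ! i = es ! j"
  have "vs ! i \<in> ends (es ! j)" "vs ! Suc i \<in> ends (es ! j)"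
    using edge_path_incident[OF assms ij(1), of i] edge_path_incident[OF assms ij(1), of "Suc i"] ij
    by auto
  then show False
    using edge_path_incident[OF assms ij(2), of i] edge_path_incident[OF assms ij(2), of "Suc i"] ij
    by auto
qed

lemma edge_path_degree_interior:
  assumes path: "edge_path V ends F vs es" and i: "0 < i" "i < length es"
  shows "degree ends (set es) (vs ! i) = 2"
proof -
  have "vs ! i \<in> ends (es ! j) \<longleftrightarrow> j = i - 1 \<or> j = i" if "j < length es" for j
    using edge_path_incident[OF path that, of i] i by auto
  then have "{e \<in> set es. vs ! i \<in> ends e} = {es ! (i - 1), es ! i}"
    using i by (auto simp: in_set_conv_nth intro: exI[of _ "i - 1"])
  moreover have "es ! (i - 1) \<noteq> es ! i"
    using edge_path_distinct[OF path] i by (simp add: nth_eq_iff_index_eq)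
  ultimately show ?thesis by (simp add: degree_def)
qed

lemma edge_path_outside_edge_at_end:
  assumes path: "edge_path V ends F vs es" and fin: "finite F"
    and deg: "degree ends F (vs ! i) \<le> 2" and i: "i \<le> length es"
    and f: "f \<in> F - set es" "vs ! i \<in> ends f"
  shows "i = 0 \<or> i = length es"
proof (rule ccontr)
  assume "\<not> ?thesis"
  then have "degree ends (set es) (vs ! i) = 2"
    using edge_path_degree_interior[OF path] i by simp
  moreover have "degree ends F (vs ! i) =
      degree ends (set es) (vs ! i) + degree ends (F - set es) (vs ! i)"
    using path fin by (intro degree_Diff) (auto simp: edge_path_def)
  ultimately have "degree ends (F - set es) (vs ! i) = 0" using deg by simp
  then show False using f fin by (simp add: degree_eq_0_iff)
qed

lemma longest_edge_path:
  assumes "finite V" "V \<noteq> {}"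
  obtains vs es where "edge_path V ends F vs es"
    "\<And>vs' es'. edge_path V ends F vs' es' \<Longrightarrow> length es' \<le> length es"
proof -
  let ?path = "\<lambda>p. edge_path V ends F (fst p) (snd p)"
  obtain v where "v \<in> V" using assms(2) by blast
  then have "?path ([v], [])" by (simp add: edge_path_def)
  moreover have "length (snd p) < card V" if "?path p" for p
    using that card_mono[OF assms(1), of "set (fst p)"]
    by (auto simp: edge_path_def distinct_card)
  ultimately obtain p where "?path p" "\<forall>q. ?path q \<longrightarrow> length (snd q) \<le> length (snd p)"
    using ex_has_greatest_nat[of ?path "([v], [])" "\<lambda>p. length (snd p)" "card V"]
    by (auto simp: less_imp_le)
  then show thesis using that by fastforce
qed

lemma edge_path_extend:
  assumes graph: "finite_graph V F ends" and deg: "\<And>v. v \<in> V \<Longrightarrow> degree ends F v \<le> 2"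
    and path: "edge_path V ends F vs es" and f: "f \<in> edge_cut ends F (set vs)"
  obtains vs' es' where "edge_path V ends F vs' es'" "length es' = Suc (length es)"
proof -
  have vs: "set vs \<subseteq> V" "length vs = Suc (length es)" using path by (auto simp: edge_path_def)
  have "finite F" "f \<in> F" and f_V: "ends f \<subseteq> V" and f_card: "card (ends f) = 2"
    using graph f by (auto simp: finite_graph_def edge_cut_def)
  obtain p u where p: "p \<in> ends f" "p \<in> set vs" and u: "u \<in> ends f" "u \<notin> set vs"
    using f by (auto simp: edge_cut_def)
  obtain a b where "ends f = {a, b}" using f_card unfolding card_2_iff by blast
  then have f_ends: "ends f = {u, p}" using p u by auto
  have "u \<in> V" using f_V u(1) by blast
  obtain i where i: "i \<le> length es" "p = vs ! i"
    using p(2) vs(2) by (metis in_set_conv_nth less_Suc_eq_le)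
  have "f \<notin> set es" using edge_path_ends_subset[OF path] u by blast
  then have "i = 0 \<or> i = length es"
    using edge_path_outside_edge_at_end[OF path \<open>finite F\<close> _ i(1)] deg \<open>f \<in> F\<close> p i(2) vs(1) by blast
  then show thesis
  proof
    assume "i = 0"
    then have "edge_path V ends F (u # vs) (f # es)"
      using edge_path_Cons[OF path \<open>f \<in> F\<close>] f_ends i(2) \<open>u \<in> V\<close> u(2) by blast
    then show thesis using that by simp
  next
    assume "i = length es"
    then have "edge_path V ends F (vs @ [u]) (es @ [f])"
      using edge_path_snoc[OF path \<open>f \<in> F\<close>] f_ends i(2) \<open>u \<in> V\<close> u(2) by blast
    then show thesis using that by simp
  qed
qed

lemma spanning_edge_path:
  assumes graph: "finite_graph V F ends" and conn: "graph_connected V ends F"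
    and deg: "\<And>v. v \<in> V \<Longrightarrow> degree ends F v \<le> 2"
  obtains vs es where "edge_path V ends F vs es" "set vs = V"
proof -
  have "finite V" using graph by (simp add: finite_graph_def)
  then obtain vs es where path: "edge_path V ends F vs es"
    and longest: "\<And>vs' es'. edge_path V ends F vs' es' \<Longrightarrow> length es' \<le> length es"
    using longest_edge_path conn unfolding graph_connected_def by metis
  have "edge_cut ends F (set vs) = {}"
    using edge_path_extend[OF graph deg path] longest by (metis Suc_n_not_le_n ex_in_conv)
  moreover have "set vs \<subseteq> V" "set vs \<noteq> {}" using path by (auto simp: edge_path_def)
  ultimately have "set vs = V"
    using conn graph graph_connected_iff_edge_cut[of F ends V] unfolding finite_graph_def by blast
  then show thesis using that path by blast
qed

lemma card_edges_2_regular: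
  assumes graph: "finite_graph V F ends" and deg: "\<And>v. v \<in> V \<Longrightarrow> degree ends F v = 2"
  shows "card F = card V"
proof -
  have "2 * card V = (\<Sum>v\<in>V. degree ends F v)" using deg by simp
  also have "\<dots> = (\<Sum>e\<in>F. card (ends e \<inter> V))"
    using graph by (intro sum_degree) (auto simp: finite_graph_def)
  also have "\<dots> = 2 * card F" using graph by (simp add: finite_graph_def Int_absorb2)
  finally show ?thesis by simp
qed

lemma cycle_on_if_2_regular:
  assumes graph: "finite_graph V F ends" and conn: "graph_connected V ends F"
    and deg: "\<And>v. v \<in> V \<Longrightarrow> degree ends F v = 2"
  shows "cycle_on V ends F"
proof -
  obtain vs es where path: "edge_path V ends F vs es" and vs: "set vs = V"
    using spanning_edge_path[OF graph conn] deg by (metis order_refl)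
  define n where "n = length es"
  have len: "length vs = Suc n" and dist: "distinct vs" and es: "set es \<subseteq> F"
    and ends: "\<And>i. i < n \<Longrightarrow> ends (es ! i) = {vs ! i, vs ! Suc i}"
    using path by (auto simp: edge_path_def n_def)
  have "finite F" using graph by (simp add: finite_graph_def)
  have "card F = Suc n"
    using card_edges_2_regular[OF graph deg] vs len distinct_card[OF dist] by simp
  moreover have "card (set es) = n"
    using edge_path_distinct[OF path] by (simp add: distinct_card n_def)
  ultimately have "card (F - set es) = 1" using es by (simp add: card_Diff_subset)
  then obtain f where f: "F - set es = {f}" unfolding One_nat_def card_1_singleton_iff by blast
  have "ends f \<subseteq> {vs ! n, vs ! 0}"
  proof
    fix v assume v: "v \<in> ends f"
    then have "v \<in> set vs" using graph f vs by (auto simp: finite_graph_def)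
    then obtain i where i: "i \<le> n" "v = vs ! i" using len by (metis in_set_conv_nth less_Suc_eq_le)
    then have "i = 0 \<or> i = n"
      using edge_path_outside_edge_at_end[OF path \<open>finite F\<close>, of i f] deg v f vs \<open>v \<in> set vs\<close>
      by (simp add: n_def)
    then show "v \<in> {vs ! n, vs ! 0}" using i(2) by blast
  qed
  moreover have "card (ends f) = 2" using graph f by (auto simp: finite_graph_def)
  ultimately have closing: "ends f = {vs ! n, vs ! 0}" and "0 < n"
    by (auto simp: card_2_iff doubleton_eq_iff intro: gr0I)
  have "ends ((es @ [f]) ! i) = {vs ! i, vs ! (Suc i mod length vs)}" if "i < length vs" for i
    using that ends[of i] closing len by (cases "i = n") (auto simp: nth_append n_def)
  moreover have "distinct (es @ [f])" "set (es @ [f]) = F" "length (es @ [f]) = length vs"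
    using edge_path_distinct[OF path] f es len by (auto simp: n_def)
  moreover have "2 \<le> length vs" using \<open>0 < n\<close> len by simp
  ultimately show ?thesis unfolding cycle_on_def using dist vs by blast
qed

lemma cycle_on_iff_connected_2_regular:
  "cycle_on V ends F \<longleftrightarrow>
     finite_graph V F ends \<and> graph_connected V ends F \<and> (\<forall>v\<in>V. degree ends F v = 2)"
  by (auto intro: cycle_on_finite_graph cycle_on_graph_connected cycle_on_degree
      cycle_on_if_2_regular)

section \<open>Squares and their matchings\<close>

lemma square_matchings_nonempty: "four_cycle ends C \<Longrightarrow> square_matchings ends C \<noteq> {}"
  by (metis four_cycle_matchings insert_not_empty)

lemma
  assumes "four_cycle ends C" "P \<in> square_matchings ends C"
  shows square_matchings_eq: "square_matchings ends C = {P, C - P}"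
    and square_matching_subset: "P \<subseteq> C"
    and card_square_matching: "card P = 2"
    and square_matching_neq_compl: "P \<noteq> C - P"
proof -
  obtain A B where matchings: "A \<noteq> B" "A \<union> B = C" "A \<inter> B = {}" "card A = 2" "card B = 2"
    "square_matchings ends C = {A, B}"
    using assms(1) by (rule four_cycle_matchings)
  then have "P = A \<and> C - P = B \<or> P = B \<and> C - P = A" using assms(2) by auto
  then show "square_matchings ends C = {P, C - P}" "P \<subseteq> C" "card P = 2" "P \<noteq> C - P"
    using matchings by auto
qed

lemma square_matching_cut:
  assumes C: "four_cycle ends C" "P \<in> square_matchings ends C"
    and compl: "edge_cut ends (C - P) W = {}"
  shows "edge_cut ends P W = {} \<or> edge_cut ends P W = P"
proof -
  have "cycle_on (verts_of ends C) ends C" using C(1) by (simp add: four_cycle_def)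
  then have "even (card (edge_cut ends C W))"
    by (intro even_card_edge_cut[of "verts_of ends C"])
      (simp_all add: cycle_on_iff_connected_2_regular)
  moreover have "P \<union> (C - P) = C" using square_matching_subset[OF C] by blast
  then have "edge_cut ends C W = edge_cut ends P W"
    using compl edge_cut_Un[of ends P "C - P" W] by simp
  moreover have "edge_cut ends P W \<subseteq> P" by (auto simp: edge_cut_def)
  moreover have "card P = 2" by (rule card_square_matching[OF C])
  moreover from this have "finite P" by (intro card_ge_0_finite) simp
  ultimately have "card (edge_cut ends P W) \<in> {0, 2}"
    using card_mono[of P "edge_cut ends P W"] by (auto simp: le_Suc_eq numeral_2_eq_2)
  then show ?thesis
    using card_subset_eq[of P "edge_cut ends P W"] \<open>edge_cut ends P W \<subseteq> P\<close> \<open>card P = 2\<close> \<open>finite P\<close>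
    by (auto dest: finite_subset)
qed

lemma card_matching_cut_Int:
  assumes P: "perfect_matching (verts_of ends C) ends C P" "card P = 2"
    and W: "edge_cut ends P W = P" and U: "edge_cut ends P U = {}" "edge_cut ends C U \<noteq> {}"
  shows "card (edge_cut ends P (W \<inter> U)) = 1"
proof -
  obtain e v w where e: "e \<in> C" "v \<in> ends e" "v \<in> U" "w \<in> ends e" "w \<notin> U"
    using U(2) by (auto simp: edge_cut_def)
  then have "v \<in> verts_of ends C" "w \<in> verts_of ends C" by (auto simp: verts_of_def)
  moreover have "\<exists>f\<in>P. x \<in> ends f" if "x \<in> verts_of ends C" for x
    using P(1) that by (auto simp: perfect_matching_def)
  ultimately obtain f g where f: "f \<in> P" "v \<in> ends f" and g: "g \<in> P" "w \<in> ends g"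
    by blast
  have "f \<notin> edge_cut ends P U" "g \<notin> edge_cut ends P U" using U(1) by simp_all
  then have f_in: "ends f \<subseteq> U" and g_out: "ends g \<inter> U = {}"
    using e(3,5) f g by (auto simp: edge_cut_def)
  have "f \<noteq> g" using f_in f g_out by blast
  then have "P = {f, g}" using P(2) f(1) g(1) by (auto simp: card_2_iff)
  moreover have "f \<in> edge_cut ends P W" using f(1) W by simp
  ultimately have "edge_cut ends P (W \<inter> U) = {f}"
    using f_in g_out by (auto simp: edge_cut_def)
  then show ?thesis by simp
qed

lemma cost_sym_diff:
  assumes "finite A" "finite B"
  shows "cost c (sym_diff A B) = cost c A - cost c (A \<inter> B) + cost c (B - A)"
proof -
  have "cost c (sym_diff A B) = cost c (A - B) + cost c (B - A)"
    unfolding cost_def by (rule sum.union_disjoint) (use assms in auto)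
  moreover have "cost c A = cost c (A - B) + cost c (A \<inter> B)"
    unfolding cost_def using sum.Int_Diff[OF assms(1), of c B] by simp
  ultimately show ?thesis by simp
qed

lemma ham_stepE:
  assumes "ham_step V ends c C H H'" and C: "four_cycle ends C"
    and "\<exists>P\<in>square_matchings ends C. graph_connected V ends (H - P)"
  obtains Q where "Q \<in> square_matchings ends C" "H' = H - Q" "graph_connected V ends (H - Q)"
    "graph_connected V ends (H - (C - Q)) \<Longrightarrow> cost c (C - Q) \<le> cost c Q"
proof -
  obtain P Q where step: "P \<noteq> Q" "square_matchings ends C = {P, Q}" "H' = H - Q"
    "graph_connected V ends (H - P) \<and> graph_connected V ends (H - Q) \<longrightarrow> cost c P \<le> cost c Q"
    "graph_connected V ends (H - P) \<noteq> graph_connected V ends (H - Q) \<longrightarrow>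
       graph_connected V ends (H - Q)"
    using assms(1) unfolding ham_step_def by blast
  have Q: "Q \<in> square_matchings ends C" using step(2) by simp
  have "P = C - Q" using square_matchings_eq[OF C Q] step(1,2) by (auto simp: doubleton_eq_iff)
  moreover have "graph_connected V ends (H - Q)" using assms(3) step(2,5) by auto
  ultimately show thesis using that[OF Q step(3)] step(4) by blast
qed

section \<open>Selections of square matchings\<close>

locale decomposed_square_graph =
  fixes V :: "'v set" and E M :: "'e set" and ends :: "'e \<Rightarrow> 'v set" and S :: "'e set set"
  assumes square_graph: "square_graph V E ends M"
    and decomposition: "square_decomposition ends (E - M) S"
begin

lemma finite_graph_E: "finite_graph V E ends"
  and graph_connected_E: "graph_connected V ends E"
  and M_subset: "M \<subseteq> E"
  and degree_M: "v \<in> V \<Longrightarrow> degree ends M v = 1"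
  using square_graph
  by (simp_all add: square_graph_def two_edge_connected_def perfect_matching_iff_degree)

lemma ends_E: "e \<in> E \<Longrightarrow> ends e \<subseteq> V" and card_ends_E: "e \<in> E \<Longrightarrow> card (ends e) = 2"
  using finite_graph_E by (simp_all add: finite_graph_def)

lemma finite_subset_E: "F \<subseteq> E \<Longrightarrow> finite F"
  using finite_graph_E by (auto simp: finite_graph_def intro: finite_subset)

lemma Union_squares: "\<Union>S = E - M"
  and four_cycle_square: "C \<in> S \<Longrightarrow> four_cycle ends C"
  and verts_of_squares_disjoint:
    "C \<in> S \<Longrightarrow> D \<in> S \<Longrightarrow> C \<noteq> D \<Longrightarrow> verts_of ends C \<inter> verts_of ends D = {}"
  using decomposition by (simp_all add: square_decomposition_def)

lemma square_subset: "C \<in> S \<Longrightarrow> C \<subseteq> E - M"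
  using Union_squares by blast

lemma finite_squares: "finite S"
  using Union_squares finite_subset_E[of "E - M"] by (intro finite_UnionD) auto

lemma squares_disjoint:
  assumes "C \<in> S" "D \<in> S" "C \<noteq> D"
  shows "C \<inter> D = {}"
proof -
  have "ends e \<noteq> {}" if "e \<in> C" for e
    using that card_ends_E[of e] square_subset[OF assms(1)] by fastforce
  then show ?thesis using verts_of_squares_disjoint[OF assms] by (force simp: verts_of_def)
qed

lemma verts_of_squares: "(\<Union>C\<in>S. verts_of ends C) = V"
proof
  show "(\<Union>C\<in>S. verts_of ends C) \<subseteq> V" using square_subset ends_E by (force simp: verts_of_def)
  show "V \<subseteq> (\<Union>C\<in>S. verts_of ends C)"
  proof
    fix v assume v: "v \<in> V"
    have "degree ends E v = degree ends M v + degree ends (E - M) v"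
      using finite_subset_E M_subset by (intro degree_Diff) auto
    moreover have "degree ends E v = 3"
      using square_graph v by (simp add: square_graph_def cubic_def degree_def)
    ultimately have "degree ends (E - M) v \<noteq> 0" using degree_M[OF v] by simp
    then obtain e where "e \<in> E - M" "v \<in> ends e"
      using finite_subset_E by (auto simp: degree_eq_0_iff)
    then show "v \<in> (\<Union>C\<in>S. verts_of ends C)"
      using Union_squares by (auto simp: verts_of_def)
  qed
qed

lemma degree_eq_Suc_square_degree:
  assumes "M \<subseteq> F" "F \<subseteq> E" "C \<in> S" "v \<in> verts_of ends C"
  shows "degree ends F v = Suc (degree ends (F \<inter> C) v)"
proof -
  have "e \<in> C" if e: "e \<in> E - M" "v \<in> ends e" for e
  proof -
    obtain D where "D \<in> S" "e \<in> D" using e(1) Union_squares by blast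
    moreover from this have "v \<in> verts_of ends D" using e(2) by (auto simp: verts_of_def)
    ultimately show ?thesis using verts_of_squares_disjoint assms(3,4) by blast
  qed
  then have "{e \<in> F - M. v \<in> ends e} = {e \<in> F \<inter> C. v \<in> ends e}"
    using assms(2) square_subset[OF assms(3)] by blast
  then have "degree ends (F - M) v = degree ends (F \<inter> C) v" by (simp add: degree_def)
  moreover have "v \<in> V" using assms(3,4) verts_of_squares by blast
  ultimately show ?thesis
    using degree_Diff[OF finite_subset_E[OF assms(2)] assms(1), of ends v] degree_M by simp
qed

definition selection_on :: "'e set set \<Rightarrow> 'e set \<Rightarrow> bool" where
  "selection_on T F \<longleftrightarrow> T \<subseteq> S \<and> M \<subseteq> F \<and> F \<subseteq> E \<and>
     (\<forall>C\<in>T. F \<inter> C \<in> square_matchings ends C) \<and> (\<forall>C\<in>S - T. C \<subseteq> F)"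

abbreviation selection :: "'e set \<Rightarrow> bool" where
  "selection \<equiv> selection_on S"

lemma selection_subset: "selection F \<Longrightarrow> F \<subseteq> E"
  by (simp add: selection_on_def)

lemma selection_iff_2_regular:
  "selection F \<longleftrightarrow> M \<subseteq> F \<and> F \<subseteq> E \<and> (\<forall>v\<in>V. degree ends F v = 2)"
proof (cases "M \<subseteq> F \<and> F \<subseteq> E")
  case True
  have "selection F \<longleftrightarrow> (\<forall>C\<in>S. \<forall>v\<in>verts_of ends C. degree ends (F \<inter> C) v = 1)"
    using True by (simp add: selection_on_def square_matchings_def perfect_matching_iff_degree)
  also have "\<dots> \<longleftrightarrow> (\<forall>C\<in>S. \<forall>v\<in>verts_of ends C. degree ends F v = 2)"
    using True by (simp add: degree_eq_Suc_square_degree)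
  also have "\<dots> \<longleftrightarrow> (\<forall>v\<in>V. degree ends F v = 2)"
    using verts_of_squares by blast
  finally show ?thesis using True by blast
qed (auto simp: selection_on_def)

lemma hamiltonian_cycle_iff_connected_selection:
  "hamiltonian_cycle V E ends F \<and> M \<subseteq> F \<longleftrightarrow> selection F \<and> graph_connected V ends F"
  unfolding hamiltonian_cycle_def cycle_on_iff_connected_2_regular selection_iff_2_regular
  using finite_graph_subset[OF finite_graph_E] by blast

lemma even_card_selection_cut:
  assumes "selection F"
  shows "even (card (edge_cut ends F W))"
  by (rule even_card_edge_cut[OF finite_graph_subset[OF finite_graph_E]])
    (use assms in \<open>simp_all add: selection_iff_2_regular\<close>)

lemma selection_square_matching:
  assumes "selection F" "C \<in> S"
  shows "F \<inter> C \<in> square_matchings ends C" "square_matchings ends C = {F \<inter> C, C - F}"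
proof -
  show F_C: "F \<inter> C \<in> square_matchings ends C" using assms by (simp add: selection_on_def)
  have "C - F \<inter> C = C - F" by blast
  then show "square_matchings ends C = {F \<inter> C, C - F}"
    using square_matchings_eq[OF four_cycle_square[OF assms(2)] F_C] by simp
qed

lemma selection_on_remove_matching:
  assumes H: "selection_on T H" and C: "C \<in> S - T" and Q: "Q \<in> square_matchings ends C"
  shows "selection_on (insert C T) (H - Q)"
proof -
  have "four_cycle ends C" using C four_cycle_square by blast
  then have Q_C: "Q \<subseteq> C" "C - Q \<in> square_matchings ends C"
    using square_matching_subset square_matchings_eq Q by blast+
  have "C \<subseteq> H" using H C by (simp add: selection_on_def)
  then have at_C: "(H - Q) \<inter> C = C - Q" by blast
  have elsewhere: "(H - Q) \<inter> D = H \<inter> D" if "D \<in> S" "D \<noteq> C" for D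
    using squares_disjoint[of D C] that C Q_C(1) by blast
  have "(H - Q) \<inter> D \<in> square_matchings ends D" if "D \<in> insert C T" for D
    using that at_C elsewhere[of D] H Q_C(2) C unfolding selection_on_def by (cases "D = C") auto
  moreover have "D \<subseteq> H - Q" if "D \<in> S - insert C T" for D
    using that elsewhere[of D] H unfolding selection_on_def by blast
  moreover have "M \<subseteq> H - Q" "H - Q \<subseteq> E" "insert C T \<subseteq> S"
    using H Q_C(1) square_subset C by (auto simp: selection_on_def)
  ultimately show ?thesis by (simp add: selection_on_def)
qed

lemma selection_on_imp_selection_subset:
  assumes "selection_on T H"
  obtains F where "selection F" "F \<subseteq> H"
  using assms
proof (induction "card (S - T)" arbitrary: T H thesis)
  case 0
  then have "T = S" using finite_squares by (auto simp: selection_on_def)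
  then show ?case using 0 by blast
next
  case (Suc n)
  then have "S - T \<noteq> {}" by force
  then obtain C where C: "C \<in> S - T" by blast
  then obtain Q where Q: "Q \<in> square_matchings ends C"
    using square_matchings_nonempty four_cycle_square by blast
  have "S - insert C T = S - T - {C}" by blast
  then have "n = card (S - insert C T)" using Suc.hyps(2) C finite_squares by simp
  then obtain F where "selection F" "F \<subseteq> H - Q"
    using Suc.hyps(1)[OF _ _ selection_on_remove_matching[OF Suc.prems(2) C Q]] by blast
  then show ?case using Suc.prems(1) by blast
qed

lemma selection_subset_Int_square:
  assumes F: "selection F" "F \<subseteq> H" and H: "selection_on T H" and C: "C \<in> T"
  shows "F \<inter> C = H \<inter> C"
proof (rule card_subset_eq)
  have "C \<in> S" using H C by (auto simp: selection_on_def)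
  then have "four_cycle ends C" by (rule four_cycle_square)
  moreover have "F \<inter> C \<in> square_matchings ends C" "H \<inter> C \<in> square_matchings ends C"
    using F(1) H C \<open>C \<in> S\<close> by (auto simp: selection_on_def)
  ultimately show "card (F \<inter> C) = card (H \<inter> C)" by (simp add: card_square_matching)
  show "finite (H \<inter> C)" using \<open>C \<in> S\<close> square_subset by (intro finite_subset_E) blast
qed (use F(2) in blast)

lemma selection_subset_eq:
  assumes "selection F" "selection H" "F \<subseteq> H"
  shows "F = H"
proof -
  have decompose: "G = M \<union> (\<Union>C\<in>S. G \<inter> C)" if "selection G" for G
    using that Union_squares by (auto simp: selection_on_def)
  have "F = M \<union> (\<Union>C\<in>S. F \<inter> C)" by (rule decompose[OF assms(1)])
  also have "\<dots> = M \<union> (\<Union>C\<in>S. H \<inter> C)"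
    using selection_subset_Int_square[OF assms(1,3,2)] by simp
  also have "\<dots> = H" by (rule decompose[OF assms(2), symmetric])
  finally show ?thesis .
qed

lemma sym_diff_Int_square:
  assumes "C \<in> S" "D \<in> S" "D \<noteq> C"
  shows "sym_diff F C \<inter> D = F \<inter> D"
  using squares_disjoint[OF assms(1,2)] assms(3) by blast

lemma selection_sym_diff:
  assumes "selection F" "C \<in> S"
  shows "selection (sym_diff F C)"
proof -
  have "sym_diff F C \<inter> D \<in> square_matchings ends D" if "D \<in> S" for D
  proof (cases "D = C")
    case True
    moreover have "sym_diff F C \<inter> C = C - F" by blast
    ultimately show ?thesis using selection_square_matching[OF assms] by simp
  next
    case False
    then show ?thesis
      using selection_square_matching(1)[OF assms(1) that] sym_diff_Int_square[OF assms(2) that]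
      by simp
  qed
  moreover have "M \<subseteq> sym_diff F C" "sym_diff F C \<subseteq> E"
    using assms(1) square_subset[OF assms(2)] by (auto simp: selection_on_def)
  ultimately show ?thesis by (simp add: selection_on_def)
qed

lemma selection_compl_if_neq:
  assumes "selection F" "selection X" "C \<in> S" "F \<inter> C \<noteq> X \<inter> C"
  shows "X \<inter> C = C - F"
  using selection_square_matching(2)[OF assms(1,3)] selection_square_matching(1)[OF assms(2,3)]
    assms(4) by auto

section \<open>The symmetric exchange property\<close>

lemma graph_connected_iff_cut_of_E:
  assumes "F \<subseteq> E"
  shows "graph_connected V ends F \<longleftrightarrow>
    (\<forall>W\<subseteq>V. edge_cut ends F W = {} \<longrightarrow> edge_cut ends E W = {})"
proof -
  have "V \<noteq> {}" and "\<forall>W\<subseteq>V. edge_cut ends E W = {} \<longrightarrow> W = {} \<or> W = V"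
    using graph_connected_E ends_E card_ends_E graph_connected_iff_edge_cut[of E ends V]
    by simp_all
  moreover have "edge_cut ends E {} = {}" "edge_cut ends E V = {}"
    using ends_E by (auto simp: edge_cut_def)
  ultimately have "edge_cut ends E W = {} \<longleftrightarrow> W = {} \<or> W = V" if "W \<subseteq> V" for W
    using that by blast
  moreover have "ends e \<subseteq> V \<and> card (ends e) = 2" if "e \<in> F" for e
    using that assms ends_E card_ends_E by blast
  ultimately show ?thesis
    using graph_connected_iff_edge_cut[of F ends V] \<open>V \<noteq> {}\<close> by simp
qed

lemma connected_edge_cut_nonempty:
  assumes "graph_connected V ends F" "F \<subseteq> E" "W \<subseteq> V" "edge_cut ends E W \<noteq> {}"
  shows "edge_cut ends F W \<noteq> {}"
  using assms(1,3,4) unfolding graph_connected_iff_cut_of_E[OF assms(2)] by blast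

lemma disconnecting_cut:
  assumes "graph_connected V ends H" "H \<subseteq> E" "F \<subseteq> H" "\<not> graph_connected V ends F"
  obtains W where "W \<subseteq> V" "edge_cut ends F W = {}" "edge_cut ends H W \<noteq> {}"
proof -
  have "F \<subseteq> E" using assms(2,3) by blast
  then obtain W where W: "W \<subseteq> V" "edge_cut ends F W = {}" "edge_cut ends E W \<noteq> {}"
    using assms(4) unfolding graph_connected_iff_cut_of_E[OF \<open>F \<subseteq> E\<close>] by blast
  show thesis by (rule that[OF W(1,2) connected_edge_cut_nonempty[OF assms(1,2) W(1,3)]])
qed

text \<open>Otherwise exactly one edge of \<open>F\<close>, a member of \<open>C\<close>, would cross \<open>U \<inter> W\<close>.\<close>

lemma edge_cut_empty_if_sym_diff_cut_empty:
  assumes F: "selection F" and C: "C \<in> S"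
    and W: "edge_cut ends F W = {}" "edge_cut ends (C - F) W \<noteq> {}"
    and U: "edge_cut ends (sym_diff F C) U = {}"
  shows "edge_cut ends F U = {}"
proof (rule ccontr)
  assume "edge_cut ends F U \<noteq> {}"
  let ?P = "F \<inter> C"
  have P: "?P \<in> square_matchings ends C" by (rule selection_square_matching(1)[OF F C])
  have F_split: "F = (F - C) \<union> ?P" by blast
  have outside: "edge_cut ends (F - C) U = {}" "edge_cut ends (F - C) W = {}"
    by (rule edge_cut_empty_mono[OF U], blast) (rule edge_cut_empty_mono[OF W(1)], blast)
  have "edge_cut ends (C - ?P) U = {}" by (rule edge_cut_empty_mono[OF U]) blast
  then have "edge_cut ends ?P U = {} \<or> edge_cut ends ?P U = ?P"
    by (rule square_matching_cut[OF four_cycle_square[OF C] P])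
  moreover have "edge_cut ends ?P U \<noteq> {}"
    using \<open>edge_cut ends F U \<noteq> {}\<close> outside(1) edge_cut_Un[of ends "F - C" ?P U] F_split by simp
  ultimately have "edge_cut ends ?P U = ?P" by blast
  moreover have "edge_cut ends ?P W = {}" "edge_cut ends C W \<noteq> {}"
    using W edge_cut_empty_mono by blast+
  ultimately have "card (edge_cut ends ?P (U \<inter> W)) = 1"
    using P card_square_matching[OF four_cycle_square[OF C] P]
    by (intro card_matching_cut_Int) (auto simp: square_matchings_def)
  moreover have "edge_cut ends (F - C) (U \<inter> W) = {}"
    using edge_cut_Int_subset[of ends "F - C" U W] outside by blast
  then have "edge_cut ends F (U \<inter> W) = edge_cut ends ?P (U \<inter> W)"
    using edge_cut_Un[of ends "F - C" ?P] F_split by simp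
  ultimately show False using even_card_selection_cut[OF F, of "U \<inter> W"] by simp
qed

lemma ex_connected_remove_matching:
  assumes H: "selection_on T H" "graph_connected V ends H" and C: "C \<in> S - T"
  shows "\<exists>P\<in>square_matchings ends C. graph_connected V ends (H - P)"
proof (rule ccontr)
  assume disconnected: "\<not> ?thesis"
  have "H \<subseteq> E" "C \<subseteq> H" "C \<in> S" using H(1) C by (auto simp: selection_on_def)
  note C_cycle = four_cycle_square[OF \<open>C \<in> S\<close>]
  obtain Q where Q: "Q \<in> square_matchings ends C"
    using square_matchings_nonempty[OF C_cycle] by blast
  then have compl_Q: "C - Q \<in> square_matchings ends C" "Q \<subseteq> C"
    using square_matchings_eq[OF C_cycle Q] square_matching_subset[OF C_cycle Q] by auto
  note deletion = selection_on_remove_matching[OF H(1) C Q]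
  obtain F where F: "selection F" "F \<subseteq> H - Q"
    by (rule selection_on_imp_selection_subset[OF deletion])
  have F_C: "F \<inter> C = C - Q"
    using selection_subset_Int_square[OF F deletion, of C] \<open>C \<subseteq> H\<close> by blast
  obtain W U where W: "edge_cut ends (H - Q) W = {}" "edge_cut ends H W \<noteq> {}"
    and U: "edge_cut ends (H - (C - Q)) U = {}" "edge_cut ends H U \<noteq> {}"
    using disconnecting_cut[OF H(2) \<open>H \<subseteq> E\<close>] disconnected Q compl_Q(1) by (metis Diff_subset)
  have "edge_cut ends F U = {}"
  proof (rule edge_cut_empty_if_sym_diff_cut_empty[OF F(1) \<open>C \<in> S\<close>])
    show "edge_cut ends F W = {}" by (rule edge_cut_empty_mono[OF W(1) F(2)])
    have "H = (H - Q) \<union> (C - F)" using F_C \<open>C \<subseteq> H\<close> compl_Q(2) by blast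
    then show "edge_cut ends (C - F) W \<noteq> {}" using W edge_cut_Un by (metis Un_empty)
    show "edge_cut ends (sym_diff F C) U = {}"
      by (rule edge_cut_empty_mono[OF U(1)]) (use F(2) F_C \<open>C \<subseteq> H\<close> in blast)
  qed
  then have "edge_cut ends (C - Q) U = {}" by (rule edge_cut_empty_mono) (use F_C in blast)
  moreover have "H = (H - (C - Q)) \<union> (C - Q)" using \<open>C \<subseteq> H\<close> by blast
  ultimately show False using U edge_cut_Un by (metis Un_empty)
qed

lemma disconnecting_cut_eq_square_matching:
  assumes F: "selection F" "graph_connected V ends F" and C: "C \<in> S" and W: "W \<subseteq> V"
    "edge_cut ends (sym_diff F C) W = {}" "edge_cut ends E W \<noteq> {}"
  shows "edge_cut ends F W = F \<inter> C"
proof -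
  have "edge_cut ends F W \<noteq> {}"
    by (rule connected_edge_cut_nonempty[OF F(2) selection_subset[OF F(1)] W(1,3)])
  moreover have "edge_cut ends (F - C) W = {}" "edge_cut ends (C - F \<inter> C) W = {}"
    by (rule edge_cut_empty_mono[OF W(2)], blast)+
  moreover have "edge_cut ends F W = edge_cut ends (F - C) W \<union> edge_cut ends (F \<inter> C) W"
    by (auto simp: edge_cut_def)
  ultimately show ?thesis
    using square_matching_cut[OF four_cycle_square[OF C] selection_square_matching(1)[OF F(1) C]]
    by (metis Un_empty_left)
qed

lemma graph_connected_sym_diff_sym_diff:
  assumes F: "selection F" "graph_connected V ends F" and C: "C \<in> S"
    and W: "W \<subseteq> V" "edge_cut ends (sym_diff F C) W = {}" "edge_cut ends E W \<noteq> {}"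
    and D: "D \<in> S" "edge_cut ends (D - sym_diff F C) W \<noteq> {}"
  shows "graph_connected V ends (sym_diff (sym_diff F C) D)"
proof (rule ccontr)
  let ?F = "sym_diff F C" let ?G = "sym_diff ?F D"
  have selF: "selection ?F" and selG: "selection ?G"
    using selection_sym_diff F(1) C D(1) by blast+
  note F_E = selection_subset[OF F(1)] and G_E = selection_subset[OF selG]
  assume "\<not> graph_connected V ends ?G"
  then obtain U where U: "U \<subseteq> V" "edge_cut ends ?G U = {}" "edge_cut ends E U \<noteq> {}"
    using disconnecting_cut[OF graph_connected_E order_refl G_E] by blast
  have "edge_cut ends ?F U = {}"
    by (rule edge_cut_empty_if_sym_diff_cut_empty[OF selF D(1) W(2) D(2) U(2)])
  then have "edge_cut ends F U = edge_cut ends F W"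
    using disconnecting_cut_eq_square_matching[OF F C] U(1,3) W by simp
  \<comment> \<open>Since \<open>F\<close> is connected, it follows that \<open>W\<close> and \<open>U\<close> are equal or complementary.\<close>
  then have "edge_cut ends F (sym_diff W U) = {}"
    using edge_cut_sym_diff[of F ends W U] F_E card_ends_E by auto
  then have "edge_cut ends E (sym_diff W U) = {}"
    using connected_edge_cut_nonempty[OF F(2) F_E, of "sym_diff W U"] U(1) W(1) by blast
  then have "edge_cut ends E W = edge_cut ends E U"
    using edge_cut_sym_diff[of E ends W U] card_ends_E by auto
  then have "edge_cut ends ?G W = {}"
    using U(2) edge_cut_subset[OF G_E, of ends] by simp
  then have "edge_cut ends (D - ?F) W = {}" by (rule edge_cut_empty_mono) blast
  then show False using D(2) by blast
qed

lemma selection_symmetric_exchange: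
  assumes F: "selection F" "graph_connected V ends F"
    and X: "selection X" "graph_connected V ends X"
    and C: "C \<in> S" "F \<inter> C \<noteq> X \<inter> C"
  shows "graph_connected V ends (sym_diff F C) \<or>
    (\<exists>D\<in>S. D \<noteq> C \<and> F \<inter> D \<noteq> X \<inter> D \<and> graph_connected V ends (sym_diff (sym_diff F C) D))"
proof (rule disj_imp[THEN iffD2], rule impI)
  let ?F = "sym_diff F C"
  assume "\<not> graph_connected V ends ?F"
  then obtain W where W: "W \<subseteq> V" "edge_cut ends ?F W = {}" "edge_cut ends E W \<noteq> {}"
    using disconnecting_cut[OF graph_connected_E order_refl]
      selection_subset[OF selection_sym_diff[OF F(1) C(1)]] by blast
  then obtain f where f: "f \<in> edge_cut ends X W"
    using connected_edge_cut_nonempty[OF X(2) selection_subset[OF X(1)]] by blast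
  then have fX: "f \<in> X" "f \<notin> ?F" using W(2) by (auto simp: edge_cut_def)
  then have "f \<in> E - M"
    using X(1) selection_sym_diff[OF F(1) C(1)] by (auto simp: selection_on_def)
  then obtain D where D: "D \<in> S" "f \<in> D" using Union_squares by blast
  have DC: "D \<noteq> C"
    using selection_compl_if_neq[OF F(1) X(1) C] fX D(2) by blast
  have "F \<inter> D \<noteq> X \<inter> D" using sym_diff_Int_square[OF C(1) D(1) DC] fX D(2) by blast
  moreover have "graph_connected V ends (sym_diff ?F D)"
  proof (rule graph_connected_sym_diff_sym_diff[OF F C(1) W D(1)])
    show "edge_cut ends (D - ?F) W \<noteq> {}" using f fX D(2) by (auto simp: edge_cut_def)
  qed
  ultimately show
    "\<exists>D\<in>S. D \<noteq> C \<and> F \<inter> D \<noteq> X \<inter> D \<and> graph_connected V ends (sym_diff ?F D)"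
    using D(1) DC by blast
qed

section \<open>Optimality of the greedy choices\<close>

lemma cost_selection_sym_diff:
  assumes "selection F" "C \<in> S"
  shows "cost c (sym_diff F C) = cost c F - cost c (F \<inter> C) + cost c (C - F)"
proof (rule cost_sym_diff)
  show "finite F" by (rule finite_subset_E[OF selection_subset[OF assms(1)]])
  show "finite C" using square_subset[OF assms(2)] by (intro finite_subset_E) blast
qed

lemma square_weight_selection:
  assumes "selection F" "C \<in> S"
  shows "square_weight ends c C = \<bar>cost c (F \<inter> C) - cost c (C - F)\<bar>"
proof (rule square_weight_eq)
  have "C - F \<inter> C = C - F" by blast
  then show "F \<inter> C \<noteq> C - F"
    using square_matching_neq_compl[OF four_cycle_square selection_square_matching(1)] assms
    by metis
qed (rule selection_square_matching(2)[OF assms])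

lemma connected_selection_cost_exchange:
  assumes F: "selection F" "graph_connected V ends F"
    and X: "selection X" "graph_connected V ends X"
    and C: "C \<in> S" "F \<inter> C \<noteq> X \<inter> C" "cost c (X \<inter> C) \<le> cost c (F \<inter> C)"
    and heaviest: "\<And>D. D \<in> S \<Longrightarrow> F \<inter> D \<noteq> X \<inter> D \<Longrightarrow> square_weight ends c D \<le> square_weight ends c C"
  obtains F' where "selection F'" "graph_connected V ends F'" "F' \<subseteq> F \<union> X" "F' \<inter> C = X \<inter> C"
    "cost c F' \<le> cost c F"
proof -
  note X_C = selection_compl_if_neq[OF F(1) X(1) C(1,2)]
  note swapped = selection_sym_diff[OF F(1) C(1)]
  note weight = square_weight_selection[OF F(1) C(1), of c]
  have gain: "cost c (sym_diff F C) = cost c F - square_weight ends c C"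
    using cost_selection_sym_diff[OF F(1) C(1), of c] weight C(3) X_C by simp
  have sub: "sym_diff F C \<subseteq> F \<union> X" "sym_diff F C \<inter> C = X \<inter> C" using X_C by blast+
  consider (one_swap) "graph_connected V ends (sym_diff F C)"
    | (two_swaps) D where "D \<in> S" "D \<noteq> C" "F \<inter> D \<noteq> X \<inter> D"
      "graph_connected V ends (sym_diff (sym_diff F C) D)"
    using selection_symmetric_exchange[OF F X C(1,2)] by blast
  then show thesis
  proof cases
    case one_swap
    have "cost c (sym_diff F C) \<le> cost c F" using gain weight by simp
    then show thesis using that[OF swapped one_swap sub] by blast
  next
    case (two_swaps D)
    let ?F = "sym_diff (sym_diff F C) D"
    have "cost c ?F \<le> cost c F"
      using cost_selection_sym_diff[OF swapped two_swaps(1), of c] heaviest[OF two_swaps(1,3)] gain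
        square_weight_selection[OF swapped two_swaps(1), of c] by simp
    moreover have "?F \<subseteq> F \<union> X"
      using sub(1) selection_compl_if_neq[OF F(1) X(1) two_swaps(1,3)] by blast
    moreover have "?F \<inter> C = X \<inter> C"
      using sub(2) sym_diff_Int_square[OF two_swaps(1) C(1) two_swaps(2)[symmetric]] by simp
    ultimately show thesis using that[OF selection_sym_diff[OF swapped two_swaps(1)] two_swaps(4)]
      by blast
  qed
qed

lemma greedy_deletion_exchange:
  assumes H: "selection_on T H" and C: "C \<in> S - T" and Q: "Q \<in> square_matchings ends C"
    and greedy: "graph_connected V ends (H - (C - Q)) \<Longrightarrow> cost c (C - Q) \<le> cost c Q"
    and heaviest: "\<And>D. D \<in> S - T \<Longrightarrow> square_weight ends c D \<le> square_weight ends c C"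
    and X: "selection X" "graph_connected V ends X" "X \<subseteq> H - Q"
    and F: "selection F" "graph_connected V ends F" "F \<subseteq> H"
  obtains F' where "selection F'" "graph_connected V ends F'" "F' \<subseteq> H - Q" "cost c F' \<le> cost c F"
proof -
  have "C \<in> S" and C_H: "C \<subseteq> H" using H C by (auto simp: selection_on_def)
  have Q_C: "Q \<subseteq> C" by (rule square_matching_subset[OF four_cycle_square[OF \<open>C \<in> S\<close>] Q])
  have X_C: "X \<inter> C = C - Q"
    using selection_subset_Int_square[OF X(1,3) selection_on_remove_matching[OF H C Q]] C_H by blast
  show thesis
  proof (cases "F \<inter> C = X \<inter> C")
    case True
    then have "F \<subseteq> H - Q" using F(3) X_C Q_C by blast
    then show thesis using that F by blast
  next
    case False
    then have "C - F = C - Q"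
      using selection_compl_if_neq[OF F(1) X(1) \<open>C \<in> S\<close>] X_C by blast
    then have F_C: "F \<inter> C = Q" and "F \<subseteq> H - (C - Q)" using Q_C F(3) by blast+
    then have "cost c (X \<inter> C) \<le> cost c (F \<inter> C)"
      unfolding X_C F_C by (intro greedy graph_connected_mono[OF F(2)])
    moreover have "square_weight ends c D \<le> square_weight ends c C"
      if "D \<in> S" "F \<inter> D \<noteq> X \<inter> D" for D
    proof (rule heaviest)
      have "X \<subseteq> H" using X(3) by blast
      then show "D \<in> S - T"
        using that selection_subset_Int_square[OF F(1,3) H] selection_subset_Int_square[OF X(1) _ H]
        by blast
    qed
    ultimately obtain F' where F': "selection F'" "graph_connected V ends F'" "F' \<subseteq> F \<union> X"
      "F' \<inter> C = X \<inter> C" "cost c F' \<le> cost c F"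
      using connected_selection_cost_exchange[OF F(1,2) X(1,2) \<open>C \<in> S\<close> False] by blast
    then have "F' \<subseteq> H - Q" using F(3) X(3) X_C Q_C by blast
    then show thesis using that F' by blast
  qed
qed

end

locale sorted_ham_run = decomposed_square_graph V E M ends "set Cs"
  for V :: "'v set" and E M :: "'e set" and ends :: "'e \<Rightarrow> 'v set" and Cs :: "'e set list" +
  fixes c :: "'e \<Rightarrow> real" and H :: "nat \<Rightarrow> 'e set"
  assumes distinct_Cs: "distinct Cs"
    and sorted_Cs: "sorted_wrt (\<lambda>C D. square_weight ends c C \<ge> square_weight ends c D) Cs"
    and run: "ham_run V E ends c Cs H"
begin

lemma unprocessed_square:
  assumes "i < length Cs"
  shows "Cs ! i \<in> set Cs - set (take i Cs)"
  using assms distinct_Cs by (auto simp: in_set_conv_nth nth_eq_iff_index_eq)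

lemma square_weight_unprocessed_le:
  assumes "i < length Cs" "D \<in> set Cs - set (take i Cs)"
  shows "square_weight ends c D \<le> square_weight ends c (Cs ! i)"
proof -
  have "D \<in> set (drop i Cs)"
    using assms(2) append_take_drop_id[of i Cs] by (metis DiffE Un_iff set_append)
  moreover have "drop i Cs = Cs ! i # drop (Suc i) Cs"
    by (rule Cons_nth_drop_Suc[OF assms(1), symmetric])
  moreover have "sorted_wrt (\<lambda>C D. square_weight ends c C \<ge> square_weight ends c D) (drop i Cs)"
    by (rule sorted_wrt_drop[OF sorted_Cs])
  ultimately show ?thesis by auto
qed

lemma ham_run_step:
  assumes i: "i < length Cs"
    and H: "selection_on (set (take i Cs)) (H i)" "graph_connected V ends (H i)"
  obtains Q where "Q \<in> square_matchings ends (Cs ! i)" "H (Suc i) = H i - Q"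
    "graph_connected V ends (H i - Q)"
    "graph_connected V ends (H i - (Cs ! i - Q)) \<Longrightarrow> cost c (Cs ! i - Q) \<le> cost c Q"
proof (rule ham_stepE)
  show "ham_step V ends c (Cs ! i) (H i) (H (Suc i))" using run i by (simp add: ham_run_def)
  show "four_cycle ends (Cs ! i)" using i by (intro four_cycle_square) simp
  show "\<exists>P\<in>square_matchings ends (Cs ! i). graph_connected V ends (H i - P)"
    by (rule ex_connected_remove_matching[OF H unprocessed_square[OF i]])
qed (rule that)

lemma ham_run_invariant:
  assumes "i \<le> length Cs"
  shows "selection_on (set (take i Cs)) (H i)" "graph_connected V ends (H i)"
proof -
  have "selection_on (set (take i Cs)) (H i) \<and> graph_connected V ends (H i)"
    using assms
  proof (induction i)
    case 0
    have "H 0 = E" using run by (simp add: ham_run_def)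
    then show ?case
      using M_subset square_subset graph_connected_E by (auto simp: selection_on_def)
  next
    case (Suc i)
    then have i: "i < length Cs" and IH: "selection_on (set (take i Cs)) (H i)"
      "graph_connected V ends (H i)" by simp_all
    obtain Q where Q: "Q \<in> square_matchings ends (Cs ! i)" "H (Suc i) = H i - Q"
      "graph_connected V ends (H i - Q)"
      using ham_run_step[OF i IH] by blast
    then show ?case
      using selection_on_remove_matching[OF IH(1) unprocessed_square[OF i] Q(1)]
      by (simp add: take_Suc_conv_app_nth i)
  qed
  then show "selection_on (set (take i Cs)) (H i)" "graph_connected V ends (H i)" by simp_all
qed

lemma ham_run_result:
  "selection (H (length Cs))" "graph_connected V ends (H (length Cs))"
  using ham_run_invariant[OF order_refl] by simp_all

lemma ham_run_result_subset:
  assumes "i \<le> length Cs"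
  shows "H (length Cs) \<subseteq> H i"
  using assms
proof (induction rule: inc_induct)
  case (step i)
  have "H (Suc i) \<subseteq> H i" using run step.hyps by (auto simp: ham_run_def ham_step_def)
  then show ?case using step.IH by blast
qed simp

lemma cheaper_connected_selection_subset:
  assumes "i \<le> length Cs" "selection F" "graph_connected V ends F"
  shows "\<exists>F'. selection F' \<and> graph_connected V ends F' \<and> F' \<subseteq> H i \<and> cost c F' \<le> cost c F"
  using assms(1)
proof (induction i)
  case 0
  have "F \<subseteq> H 0" using selection_subset[OF assms(2)] run by (simp add: ham_run_def)
  then show ?case using assms(2,3) by blast
next
  case (Suc i)
  then have i: "i < length Cs" by simp
  then obtain F' where F': "selection F'" "graph_connected V ends F'" "F' \<subseteq> H i"
    "cost c F' \<le> cost c F" using Suc.IH by auto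
  note invariant = ham_run_invariant[OF less_imp_le[OF i]]
  obtain Q where Q: "Q \<in> square_matchings ends (Cs ! i)" "H (Suc i) = H i - Q"
    "graph_connected V ends (H i - (Cs ! i - Q)) \<Longrightarrow> cost c (Cs ! i - Q) \<le> cost c Q"
    using ham_run_step[OF i invariant] by blast
  have "H (length Cs) \<subseteq> H i - Q" using ham_run_result_subset[OF Suc.prems] Q(2) by simp
  then obtain F'' where "selection F''" "graph_connected V ends F''" "F'' \<subseteq> H i - Q"
    "cost c F'' \<le> cost c F'"
    using greedy_deletion_exchange[OF invariant(1) unprocessed_square[OF i] Q(1,3)
        square_weight_unprocessed_le[OF i] ham_run_result _ F'(1-3)] by blast
  then show ?case using F'(4) Q(2) by (metis order_trans)
qed

lemma ham_run_optimal:
  assumes "selection F" "graph_connected V ends F"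
  shows "cost c (H (length Cs)) \<le> cost c F"
proof -
  obtain F' where "selection F'" "F' \<subseteq> H (length Cs)" "cost c F' \<le> cost c F"
    using cheaper_connected_selection_subset[OF order_refl assms] by blast
  then show ?thesis using selection_subset_eq[OF _ ham_run_result(1)] by blast
qed

end

theorem theorem12:
  fixes V :: "'v set" and E M :: "'e set" and ends :: "'e \<Rightarrow> 'v set"
    and c :: "'e \<Rightarrow> real" and Cs :: "'e set list" and H :: "nat \<Rightarrow> 'e set"
  assumes "square_graph V E ends M"
    and "distinct Cs" and "square_decomposition ends (E - M) (set Cs)"
    and "sorted_wrt (\<lambda>C D. square_weight ends c C \<ge> square_weight ends c D) Cs"
    and "ham_run V E ends c Cs H"
  shows "(\<forall>i < length Cs. \<exists>P \<in> square_matchings ends (Cs ! i).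
            graph_connected V ends (H i - P)) \<and>
         hamiltonian_cycle V E ends (H (length Cs)) \<and> M \<subseteq> H (length Cs) \<and>
         (\<forall>F. hamiltonian_cycle V E ends F \<and> M \<subseteq> F \<longrightarrow> cost c (H (length Cs)) \<le> cost c F)"
proof -
  interpret sorted_ham_run V E M ends Cs c H
    using assms by unfold_locales
  have "\<exists>P\<in>square_matchings ends (Cs ! i). graph_connected V ends (H i - P)"
    if "i < length Cs" for i
    by (rule ex_connected_remove_matching[OF ham_run_invariant unprocessed_square])
      (use that in simp_all)
  moreover have "hamiltonian_cycle V E ends (H (length Cs)) \<and> M \<subseteq> H (length Cs)"
    unfolding hamiltonian_cycle_iff_connected_selection using ham_run_result by blast
  moreover have "cost c (H (length Cs)) \<le> cost c F"
    if "hamiltonian_cycle V E ends F \<and> M \<subseteq> F" for F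
    using that ham_run_optimal unfolding hamiltonian_cycle_iff_connected_selection by blast
  ultimately show ?thesis by blast
qed

end
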